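(* Let $n\geq 5$ and $\chi\geq 3$ be integers, and let $q=\lfloor n/\chi\rfloor$ and $r=n-q\chi$. If $G$ is a connected graph of order $n$ with chromatic number $\chi$, then $$ABS(G)\leq \frac{(\chi-r)(\chi-r-1)q^2}{2}\sqrt{\frac{n-q-1}{n-q}}+r(\chi-r)q(q+1)\sqrt{\frac{2n-2q-3}{2n-2q-1}}+\frac{r(r-1)(q+1)^2}{2}\sqrt{\frac{n-q-2}{n-q-1}},$$ with equality if and only if $G\cong T_{n,\chi}$.
   Context: All graphs are finite and simple. For a graph $G$ with vertex degrees $d_v$, the atom-bond sum-connectivity index is $ABS(G)=\sum_{uv\in E(G)}\left(\frac{d_u+d_v-2}{d_u+d_v}\right)^{1/2}$. $T_{n,\chi}$ denotes the complete $\chi$-partite graph of order $n$ whose partite sets have sizes $k_1,\dots,k_\chi$ with $|k_i-k_j|\le 1$ for all $i,j$. *)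

theory Defs
  imports Complex_Main "Graph_Theory.Graph_Theory"
begin

text \<open>
  A finite simple graph is a \<^locale>\<open>pair_graph\<close>: finitely many vertices and a symmetric irreflexive
  set of arcs, so every undirected edge is represented by two opposite arcs.
\<close>

definition edges :: "'a pair_pre_digraph \<Rightarrow> 'a set set" where
  "edges G = (\<lambda>(u, v). {u, v}) ` parcs G"

text \<open>By symmetry of the arc set, the out-degree is the degree of the undirected graph.\<close>

definition degree :: "'a pair_pre_digraph \<Rightarrow> 'a \<Rightarrow> nat" where
  "degree G v = out_degree (with_proj G) v"

text \<open>For an edge \<open>e = {u, v}\<close> of a loopless graph, \<open>\<Sum>w\<in>e. degree G w\<close> is \<open>d\<^sub>u + d\<^sub>v\<close>.\<close>

definition ABS :: "'a pair_pre_digraph \<Rightarrow> real" where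
  "ABS G = (\<Sum>e\<in>edges G.
     sqrt ((real (\<Sum>w\<in>e. degree G w) - 2) / real (\<Sum>w\<in>e. degree G w)))"

definition proper_coloring :: "'a pair_pre_digraph \<Rightarrow> nat \<Rightarrow> ('a \<Rightarrow> nat) \<Rightarrow> bool" where
  "proper_coloring G k c \<longleftrightarrow>
     (\<forall>v\<in>pverts G. c v < k) \<and> (\<forall>(u, v)\<in>parcs G. c u \<noteq> c v)"

definition chromatic_number :: "'a pair_pre_digraph \<Rightarrow> nat" where
  "chromatic_number G = (LEAST k. \<exists>c. proper_coloring G k c)"

text \<open>The complete \<open>m\<close>-partite graph with parts of sizes \<open>k 0, \<dots>, k (m - 1)\<close>;
  the first component of a vertex is the index of its part.\<close>

definition complete_multipartite :: "nat \<Rightarrow> (nat \<Rightarrow> nat) \<Rightarrow> (nat \<times> nat) pair_pre_digraph" where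
  "complete_multipartite m k =
     (let V = (SIGMA i:{..<m}. {..<k i}) in
      \<lparr> pverts = V, parcs = {(u, v). u \<in> V \<and> v \<in> V \<and> fst u \<noteq> fst v} \<rparr>)"

text \<open>Up to the order of the parts, the only way to write \<open>n\<close> as a sum of \<open>m\<close> sizes that differ
  pairwise by at most one is to take \<open>n mod m\<close> sizes \<open>n div m + 1\<close> and the others \<open>n div m\<close>.\<close>

definition turan_part_size :: "nat \<Rightarrow> nat \<Rightarrow> nat \<Rightarrow> nat" where
  "turan_part_size n m i = n div m + (if i < n mod m then 1 else 0)"

definition turan_graph :: "nat \<Rightarrow> nat \<Rightarrow> (nat \<times> nat) pair_pre_digraph" where
  "turan_graph n m = complete_multipartite m (turan_part_size n m)"

lemma pair_graph_complete_multipartite: "pair_graph (complete_multipartite m k)"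
proof
  let ?V = "SIGMA i:{..<m}. {..<k i}"
  have "parcs (complete_multipartite m k) \<subseteq> ?V \<times> ?V"
    by (auto simp: complete_multipartite_def Let_def)
  then show "finite (parcs (complete_multipartite m k))"
    by (rule finite_subset) simp
qed (auto simp: complete_multipartite_def Let_def symmetric_def sym_def)

lemma turan_part_size_balanced:
  "\<bar>int (turan_part_size n m i) - int (turan_part_size n m j)\<bar> \<le> 1"
  by (simp add: turan_part_size_def)

lemma sum_turan_part_size:
  assumes "m > 0"
  shows "(\<Sum>i<m. turan_part_size n m i) = n"
proof -
  have "{..<m} \<inter> {i. i < n mod m} = {..<n mod m}"
    using mod_less_divisor[OF assms, of n] by auto
  then have "(\<Sum>i<m. if i < n mod m then 1 else 0) = n mod m"
    by (simp add: sum.If_cases)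
  then show ?thesis
    by (simp add: turan_part_size_def sum.distrib)
qed

end

theory Submission
  imports Defs
begin

text \<open>
  A proper \<open>\<chi>\<close>-colouring with classes of sizes \<open>k\<^sub>i\<close> embeds \<open>G\<close> into the complete multipartite graph on
  these classes. The weight \<open>w(t) = sqrt ((t - 2) / t)\<close> of an edge with degree sum \<open>t\<close> is increasing, so
  \<open>ABS\<close> only grows, and strictly unless all edges between different classes are present. It remains
  to maximise \<open>\<Sum>\<^sub>i\<^sub><\<^sub>j k\<^sub>i k\<^sub>j w(2n - k\<^sub>i - k\<^sub>j)\<close> subject to \<open>\<Sum>\<^sub>i k\<^sub>i = n\<close>. If \<open>k\<^sub>a \<ge> k\<^sub>b + 2\<close>, moving one vertex from
  class \<open>a\<close> to class \<open>b\<close> strictly increases the sum: the product \<open>k\<^sub>a k\<^sub>b\<close> grows while its weight is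
  unchanged, and the terms involving a third class do not decrease because \<open>w\<close> is increasing with
  decreasing increments. Hence the maximisers are exactly the balanced size vectors.
\<close>

section \<open>The weight of an edge: monotonicity and discrete concavity\<close>

definition edge_weight :: "real \<Rightarrow> real" where
  "edge_weight t = sqrt ((t - 2) / t)"

lemma edge_weight_mono:
  assumes "2 \<le> s" "s \<le> t"
  shows "edge_weight s \<le> edge_weight t"
  using assms by (auto simp: edge_weight_def field_simps)

lemma edge_weight_nonneg: "2 \<le> t \<Longrightarrow> 0 \<le> edge_weight t"
  by (simp add: edge_weight_def)

lemma edge_weight_pos: "2 < t \<Longrightarrow> 0 < edge_weight t"
  by (simp add: edge_weight_def)

text \<open>Rationalising: the squares \<open>(t - 1) / (t + 1)\<close> and
  \<open>(t - 2) / t\<close> differ by \<open>2 / (t * (t + 1))\<close>, and the sum of the two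
  weights is positive. In this form the dependence on \<open>t\<close> can be read off.\<close>

lemma edge_weight_diff:
  assumes "2 \<le> t"
  shows "edge_weight (t + 1) - edge_weight t =
    2 / (t * (t + 1)) / (edge_weight (t + 1) + edge_weight t)"
proof -
  have pos: "0 < edge_weight (t + 1) + edge_weight t"
    using assms edge_weight_pos[of "t + 1"] edge_weight_nonneg[of t] by linarith
  have "(edge_weight (t + 1) - edge_weight t) * (edge_weight (t + 1) + edge_weight t)
      = (edge_weight (t + 1))\<^sup>2 - (edge_weight t)\<^sup>2"
    by (simp add: algebra_simps power2_eq_square)
  also have "\<dots> = (t - 1) / (t + 1) - (t - 2) / t"
    using assms by (simp add: edge_weight_def)
  also have "\<dots> = 2 / (t * (t + 1))"
    using assms by (simp add: divide_simps) (simp add: algebra_simps)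
  finally show ?thesis
    using pos by (subst nonzero_eq_divide_eq) auto
qed

text \<open>In the quotient of \<open>edge_weight_diff\<close> the numerator decreases and the
  denominator increases with \<open>t\<close>.\<close>

lemma edge_weight_diff_antimono:
  assumes "2 \<le> s" "s \<le> t"
  shows "edge_weight (t + 1) - edge_weight t \<le> edge_weight (s + 1) - edge_weight s"
proof -
  have prod: "s * (s + 1) \<le> t * (t + 1)"
    using assms by (intro mult_mono) auto
  then have num: "2 / (t * (t + 1)) \<le> 2 / (s * (s + 1))"
    using prod assms by (intro divide_left_mono) auto
  have den: "0 < edge_weight (s + 1) + edge_weight s"
    using assms edge_weight_pos[of "s + 1"] edge_weight_nonneg[of s] by linarith
  have "edge_weight (s + 1) + edge_weight s \<le> edge_weight (t + 1) + edge_weight t"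
    using assms by (intro add_mono edge_weight_mono) auto
  with num den prod show ?thesis
    using assms by (subst (1 2) edge_weight_diff, simp, simp, intro frac_le) simp_all
qed

text \<open>Used with \<open>T\<close> equal to \<open>2n\<close> minus the size of a third class,
  and \<open>x\<close>, \<open>y\<close> the sizes of the two classes that change. The gain is
  \<open>x - 1\<close> times the increment of the weight at \<open>T - x\<close>, minus
  \<open>y\<close> times its increment at \<open>T - (y + 1)\<close>, plus
  \<open>edge_weight (T - (y + 1)) - edge_weight (T - x)\<close>. Concavity and
  \<open>y \<le> x - 1\<close> compare the first two terms; monotonicity handles the last.\<close>

lemma edge_weight_transfer:
  fixes x y T :: real
  assumes "0 \<le> y" "y + 2 \<le> x" "2 \<le> T - x"
  shows "x * edge_weight (T - x) + y * edge_weight (T - y)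
    \<le> (x - 1) * edge_weight (T - (x - 1)) + (y + 1) * edge_weight (T - (y + 1))"
proof -
  have eq: "T - x + 1 = T - (x - 1)" "T - (y + 1) + 1 = T - y"
    by simp_all
  have *: "edge_weight (T - y) - edge_weight (T - (y + 1))
      \<le> edge_weight (T - (x - 1)) - edge_weight (T - x)"
    using edge_weight_diff_antimono[of "T - x" "T - (y + 1)"] assms by (simp only: eq)
  have "0 \<le> edge_weight (T - y) - edge_weight (T - (y + 1))"
    using edge_weight_mono[of "T - (y + 1)" "T - y"] assms by simp
  then have "y * (edge_weight (T - y) - edge_weight (T - (y + 1)))
      \<le> (x - 1) * (edge_weight (T - (x - 1)) - edge_weight (T - x))"
    using assms * by (intro mult_mono) auto
  moreover have "edge_weight (T - x) \<le> edge_weight (T - (y + 1))"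
    using assms by (intro edge_weight_mono) auto
  ultimately show ?thesis
    by (simp add: algebra_simps)
qed

section \<open>Class sizes: moving one vertex from a larger to a smaller class\<close>

text \<open>A vertex in part \<open>i\<close> has degree \<open>n - k i\<close>; the division by 2 corrects for summing over ordered pairs.\<close>

definition multipartite_ABS :: "nat \<Rightarrow> nat \<Rightarrow> (nat \<Rightarrow> nat) \<Rightarrow> real" where
  "multipartite_ABS n m k = (\<Sum>i<m. \<Sum>j<m. if i = j then 0 else
     real (k i) * real (k j) * edge_weight (2 * real n - real (k i) - real (k j))) / 2"

lemma multipartite_ABS_cong:
  "(\<And>i. i < m \<Longrightarrow> k i = k' i) \<Longrightarrow> multipartite_ABS n m k = multipartite_ABS n m k'"
  unfolding multipartite_ABS_def by (intro arg_cong[where f = "\<lambda>x. x / 2"] sum.cong) auto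

text \<open>Isolates what can change when only the entries at \<open>a\<close> and \<open>b\<close>
  do: the last double sum avoids both indices, and all other nonzero terms occur in both orders,
  whence the factors 2.\<close>

lemma symmetric_double_sum_split:
  fixes p :: "'b \<Rightarrow> 'b \<Rightarrow> real"
  assumes "finite M" "a \<in> M" "b \<in> M" "a \<noteq> b"
    and sym: "\<And>i j. p i j = p j i" and diag: "\<And>i. p i i = 0"
  shows "(\<Sum>i\<in>M. \<Sum>j\<in>M. p i j) =
    2 * p a b + 2 * (\<Sum>l\<in>M - {a, b}. p a l + p b l) + (\<Sum>i\<in>M - {a, b}. \<Sum>j\<in>M - {a, b}. p i j)"
proof -
  define R where "R = M - {a, b}"
  have M: "M = insert a (insert b R)" and R: "finite R" "a \<notin> R" "b \<notin> R"
    using assms by (auto simp: R_def)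
  have "(\<Sum>i\<in>R. p i a + (p i b + sum (p i) R))
      = (\<Sum>l\<in>R. p a l) + ((\<Sum>l\<in>R. p b l) + (\<Sum>i\<in>R. sum (p i) R))"
    by (simp add: sum.distrib sym[of _ a] sym[of _ b])
  moreover have "(\<Sum>i\<in>M. \<Sum>j\<in>M. p i j) = p a b + (\<Sum>l\<in>R. p a l)
      + (p a b + (\<Sum>l\<in>R. p b l) + (\<Sum>i\<in>R. p i a + (p i b + sum (p i) R)))"
    using R \<open>a \<noteq> b\<close> by (simp add: M diag sym[of b a])
  ultimately show ?thesis
    unfolding R_def[symmetric] by (simp add: sum.distrib)
qed

text \<open>Strictness comes from the pair \<open>a\<close>, \<open>b\<close> alone, whose weight is
  positive because its degree sum is at least \<open>n \<ge> 3\<close>. Each third class contributes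
  a weak inequality by \<open>edge_weight_transfer\<close>.\<close>

lemma multipartite_ABS_transfer:
  fixes n m :: nat and k :: "nat \<Rightarrow> nat"
  assumes "3 \<le> n" and sum: "(\<Sum>i<m. k i) = n"
    and ab: "a < m" "b < m" "k b + 2 \<le> k a"
  defines "k' \<equiv> k(a := k a - 1, b := k b + 1)"
  shows "(\<Sum>i<m. k' i) = n" and "multipartite_ABS n m k < multipartite_ABS n m k'"
proof -
  define R where "R = {..<m} - {a, b}"
  have "a \<noteq> b" using ab by auto
  have M: "{..<m} = insert a (insert b R)" and R: "finite R" "a \<notin> R" "b \<notin> R"
    using ab by (auto simp: R_def)
  have k'R: "k' l = k l" if "l \<in> R" for l
    using that by (auto simp: k'_def R_def)
  have k'a: "k' a = k a - 1" and k'b: "k' b = k b + 1"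
    using \<open>a \<noteq> b\<close> by (auto simp: k'_def)
  have n: "k a + k b + sum k R = n"
    using sum R \<open>a \<noteq> b\<close> by (simp add: M)
  have "sum k' R = sum k R"
    by (intro sum.cong) (auto simp: k'R)
  then show "(\<Sum>i<m. k' i) = n"
    using n R \<open>a \<noteq> b\<close> ab by (simp add: M k'a k'b)
  define p where "p k i j = (if i = j then 0 else
     real (k i) * real (k j) * edge_weight (2 * real n - real (k i) - real (k j)))"
    for k :: "nat \<Rightarrow> nat" and i j :: nat
  have sym: "p k i j = p k j i" and diag: "p k i i = 0" for k i j
    by (auto simp: p_def diff_diff_eq add.commute)
  have F: "2 * multipartite_ABS n m k =
      2 * p k a b + 2 * (\<Sum>l\<in>R. p k a l + p k b l) + (\<Sum>i\<in>R. \<Sum>j\<in>R. p k i j)" for k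
    using symmetric_double_sum_split[of "{..<m}" a b "p k"] sym diag ab \<open>a \<noteq> b\<close>
    unfolding multipartite_ABS_def R_def p_def[symmetric] by simp
  have "(\<Sum>i\<in>R. \<Sum>j\<in>R. p k i j) = (\<Sum>i\<in>R. \<Sum>j\<in>R. p k' i j)"
    by (intro sum.cong) (auto simp: p_def k'R)
  moreover have "p k a l + p k b l \<le> p k' a l + p k' b l" if "l \<in> R" for l
  proof -
    have "k l \<le> sum k R"
      using that R by (intro member_le_sum) auto
    with n have le: "k a + k b + k l \<le> n" by simp
    \<comment> \<open>The three classes are distinct, so this argument is at least \<open>n\<close>
      and lies in the range where \<open>edge_weight\<close> is monotone.\<close>
    have "2 \<le> 2 * real n - real (k l) - real (k a)"
      using le \<open>3 \<le> n\<close> by linarith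
    then have "real (k a) * edge_weight (2 * real n - real (k l) - real (k a))
        + real (k b) * edge_weight (2 * real n - real (k l) - real (k b))
        \<le> real (k' a) * edge_weight (2 * real n - real (k l) - real (k' a))
        + real (k' b) * edge_weight (2 * real n - real (k l) - real (k' b))"
      using edge_weight_transfer[of "real (k b)" "real (k a)" "2 * real n - real (k l)"] ab
      by (simp add: k'a k'b of_nat_diff add.commute)
    from mult_left_mono[OF this, of "real (k l)"] show ?thesis
      using that R by (auto simp: p_def k'R algebra_simps)
  qed
  then have "(\<Sum>l\<in>R. p k a l + p k b l) \<le> (\<Sum>l\<in>R. p k' a l + p k' b l)"
    by (rule sum_mono)
  moreover have "p k a b < p k' a b"
  proof -
    have "2 < 2 * real n - real (k a) - real (k b)"
      using n \<open>3 \<le> n\<close> by linarith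
    then have w: "0 < edge_weight (2 * real n - real (k a) - real (k b))"
      by (rule edge_weight_pos)
    \<comment> \<open>The gain \<open>k a - k b - 1\<close> is at least 1, as the sizes differ by at
      least 2.\<close>
    have "real (k' a) * real (k' b) = real (k a) * real (k b) + (real (k a) - real (k b) - 1)"
      using ab by (simp add: k'a k'b of_nat_diff algebra_simps)
    then have "real (k a) * real (k b) < real (k' a) * real (k' b)"
      using ab by simp
    moreover have "2 * real n - real (k' a) - real (k' b) = 2 * real n - real (k a) - real (k b)"
      using ab by (simp add: k'a k'b of_nat_diff)
    ultimately show ?thesis
      using mult_strict_right_mono[OF _ w] \<open>a \<noteq> b\<close> by (simp only: p_def if_False)
  qed
  ultimately show "multipartite_ABS n m k < multipartite_ABS n m k'"
    using F[of k] F[of k'] by linarith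
qed

section \<open>Balanced size vectors and the maximum\<close>

definition turan_ABS :: "nat \<Rightarrow> nat \<Rightarrow> real" where
  "turan_ABS n m = multipartite_ABS n m (turan_part_size n m)"

text \<open>With \<open>p\<close> the least size and \<open>S\<close> the indices of size
  \<open>p + 1\<close>, the total is \<open>m * p + card S\<close>. An index attaining the minimum
  is not in \<open>S\<close>, so \<open>card S < m\<close>, and uniqueness of division with
  remainder identifies \<open>p\<close> and \<open>card S\<close>.\<close>

lemma balanced_sizes:
  fixes k :: "nat \<Rightarrow> nat"
  assumes "0 < m" and sum: "(\<Sum>i<m. k i) = n"
    and bal: "\<And>i j. i < m \<Longrightarrow> j < m \<Longrightarrow> k i \<le> k j + 1"
  obtains S where "S \<subseteq> {..<m}" "card S = n mod m"
    "\<And>i. i < m \<Longrightarrow> k i = n div m + (if i \<in> S then 1 else 0)"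
proof
  define p where "p = Min (k ` {..<m})"
  define S where "S = {i. i < m \<and> k i = p + 1}"
  have "p \<in> k ` {..<m}"
    unfolding p_def using \<open>0 < m\<close> by (intro Min_in) auto
  then obtain a where a: "a < m" "k a = p" by auto
  have p_le: "p \<le> k i" if "i < m" for i
    unfolding p_def using that by (intro Min_le) auto
  have k: "k i = p + (if i \<in> S then 1 else 0)" if "i < m" for i
    using p_le[OF that] bal[OF that \<open>a < m\<close>] a that by (auto simp: S_def)
  show S: "S \<subseteq> {..<m}" by (auto simp: S_def)
  have "n = (\<Sum>i<m. p + (if i \<in> S then 1 else 0))"
    unfolding sum[symmetric] by (intro sum.cong) (auto simp: k)
  also have "\<dots> = m * p + card S"
    using S by (simp add: sum.distrib sum.If_cases Int_absorb1)
  finally have n: "n = m * p + card S" .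
  have "a \<notin> S" using a by (auto simp: S_def)
  with a S have "S \<subset> {..<m}" by auto
  then have "card S < m"
    using psubset_card_mono[of "{..<m}" S] by simp
  with n show "card S = n mod m" by simp
  have "p = n div m" using n \<open>card S < m\<close> by simp
  with k show "\<And>i. i < m \<Longrightarrow> k i = n div m + (if i \<in> S then 1 else 0)" by simp
qed

lemma sum_off_diagonal_const:
  "finite A \<Longrightarrow> (\<Sum>i\<in>A. \<Sum>j\<in>A. if i = j then 0 else c) = real (card A) * (real (card A) - 1) * c"
proof -
  assume A: "finite A"
  have "(\<Sum>j\<in>A. if i = j then 0 else c) = (real (card A) - 1) * c" if "i \<in> A" for i
  proof -
    have "(\<Sum>j\<in>A. if i = j then 0 else c) = (\<Sum>j\<in>A. c - (if i = j then c else 0))"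
      by (intro sum.cong) auto
    then show ?thesis
      using A that by (simp add: sum_subtractf algebra_simps)
  qed
  then show ?thesis by simp
qed

text \<open>Only three kinds of pairs of parts occur: small-small, mixed and large-large, each with
  a constant term. Mixed pairs are met in both orders, which cancels the division by 2.\<close>

lemma multipartite_ABS_balanced:
  assumes S: "S \<subseteq> {..<m}" "card S = r"
    and k: "\<And>i. i < m \<Longrightarrow> k i = q + (if i \<in> S then 1 else 0)"
  shows "multipartite_ABS n m k =
      (real m - real r) * (real m - real r - 1) * (real q)\<^sup>2 / 2 * edge_weight (2 * real n - 2 * real q)
    + real r * (real m - real r) * real q * (real q + 1) * edge_weight (2 * real n - 2 * real q - 1)
    + real r * (real r - 1) * (real q + 1)\<^sup>2 / 2 * edge_weight (2 * real n - 2 * real q - 2)"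
proof -
  define T where "T = {..<m} - S"
  have fin: "finite S" "finite T"
    using S finite_subset[of S "{..<m}"] by (auto simp: T_def)
  have M: "{..<m} = T \<union> S" and disj: "T \<inter> S = {}"
    using S by (auto simp: T_def)
  have "card T = m - r"
    unfolding T_def using S fin by (simp add: card_Diff_subset)
  moreover have "r \<le> m"
    using S card_mono[of "{..<m}" S] by simp
  ultimately have T: "real (card T) = real m - real r" by simp
  define e\<^sub>0 e\<^sub>1 e\<^sub>2
    where e: "e\<^sub>0 = edge_weight (2 * real n - 2 * real q)"
      "e\<^sub>1 = edge_weight (2 * real n - 2 * real q - 1)"
      "e\<^sub>2 = edge_weight (2 * real n - 2 * real q - 2)"
  define x where "x = (real q)\<^sup>2 * edge_weight (2 * real n - 2 * real q)"
  define y where "y = real q * (real q + 1) * edge_weight (2 * real n - 2 * real q - 1)"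
  define z where "z = (real q + 1)\<^sup>2 * edge_weight (2 * real n - 2 * real q - 2)"
  define p where "p i j = (if i = j then 0 else
     real (k i) * real (k j) * edge_weight (2 * real n - real (k i) - real (k j)))" for i j
  have kT: "k i = q" if "i \<in> T" for i using that k by (auto simp: T_def)
  have kS: "k i = q + 1" if "i \<in> S" for i using that k S by auto
  have "(\<Sum>i\<in>T. \<Sum>j\<in>T. p i j) = (\<Sum>i\<in>T. \<Sum>j\<in>T. if i = j then 0 else x)"
    by (intro sum.cong refl) (simp add: p_def x_def kT power2_eq_square algebra_simps)
  moreover have "(\<Sum>i\<in>S. \<Sum>j\<in>S. p i j) = (\<Sum>i\<in>S. \<Sum>j\<in>S. if i = j then 0 else z)"
    by (intro sum.cong refl) (simp add: p_def z_def kS power2_eq_square algebra_simps)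
  moreover have "(\<Sum>i\<in>T. \<Sum>j\<in>S. p i j) = (\<Sum>i\<in>T. \<Sum>j\<in>S. y)"
    using disj by (intro sum.cong refl) (auto simp: p_def y_def kS kT algebra_simps)
  moreover have "(\<Sum>i\<in>S. \<Sum>j\<in>T. p i j) = (\<Sum>i\<in>S. \<Sum>j\<in>T. y)"
    using disj by (intro sum.cong refl) (auto simp: p_def y_def kS kT algebra_simps)
  moreover have "2 * multipartite_ABS n m k = (\<Sum>i\<in>T. \<Sum>j\<in>T. p i j) + (\<Sum>i\<in>T. \<Sum>j\<in>S. p i j)
      + ((\<Sum>i\<in>S. \<Sum>j\<in>T. p i j) + (\<Sum>i\<in>S. \<Sum>j\<in>S. p i j))"
    unfolding multipartite_ABS_def p_def[symmetric] M
    using fin disj by (simp add: sum.union_disjoint sum.distrib)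
  ultimately have "2 * multipartite_ABS n m k =
      (real m - real r) * (real m - real r - 1) * x + 2 * (real r * (real m - real r) * y)
      + real r * (real r - 1) * z"
    using fin S(2) by (simp add: sum_off_diagonal_const T)
  \<comment> \<open>Folding the three weights into constants keeps their arguments intact while the
    coefficients are normalised.\<close>
  then show ?thesis
    unfolding x_def y_def z_def e[symmetric] by (simp add: field_simps)
qed

text \<open>The closed form depends on \<open>S\<close> only through its cardinality, so
  \<open>S\<close> may be replaced by the initial segment used in
  \<open>turan_part_size\<close>.\<close>

lemma multipartite_ABS_balanced_eq_turan:
  assumes "0 < m" "(\<Sum>i<m. k i) = n"
    "\<And>i j. i < m \<Longrightarrow> j < m \<Longrightarrow> k i \<le> k j + 1"
  shows "multipartite_ABS n m k = turan_ABS n m"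
proof -
  obtain S where S: "S \<subseteq> {..<m}" "card S = n mod m"
    "\<And>i. i < m \<Longrightarrow> k i = n div m + (if i \<in> S then 1 else 0)"
    using balanced_sizes[OF assms] by blast
  have "n mod m < m" using assms by simp
  then have T: "{..<n mod m} \<subseteq> {..<m}" "card {..<n mod m} = n mod m"
    "\<And>i. i < m \<Longrightarrow> turan_part_size n m i = n div m + (if i \<in> {..<n mod m} then 1 else 0)"
    by (auto simp: turan_part_size_def)
  show ?thesis
    unfolding turan_ABS_def
    by (rule trans[OF multipartite_ABS_balanced multipartite_ABS_balanced[symmetric]])
      (fact S T)+
qed

text \<open>A maximiser exists by finiteness, and it must be balanced, since otherwise a transfer
  would increase the value.\<close>

lemma multipartite_ABS_le_turan:
  assumes "3 \<le> n" "0 < m" and sum: "(\<Sum>i<m. k i) = n"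
  shows "multipartite_ABS n m k \<le> turan_ABS n m"
proof -
  \<comment> \<open>Size vectors are arbitrary outside \<open>{..<m}\<close>, so infinitely many
    represent the same sizes; extensional functions leave a finite set.\<close>
  define K where "K = {k \<in> {..<m} \<rightarrow>\<^sub>E {..n}. (\<Sum>i<m. k i) = n}"
  have in_K: "restrict k {..<m} \<in> K" if "(\<Sum>i<m. k i) = n" for k
  proof -
    have "k i \<le> n" if "i < m" for i
      using member_le_sum[of i "{..<m}" k] that \<open>(\<Sum>i<m. k i) = n\<close> by simp
    with that show ?thesis by (auto simp: K_def)
  qed
  have restrict: "multipartite_ABS n m (restrict k {..<m}) = multipartite_ABS n m k" for k
    by (intro multipartite_ABS_cong) simp
  have "finite K"
    unfolding K_def by (intro finite_subset[OF _ finite_PiE[of "{..<m}" "\<lambda>_. {..n}"]]) auto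
  moreover have "K \<noteq> {}" using in_K[OF sum] by auto
  ultimately have "Max (multipartite_ABS n m ` K) \<in> multipartite_ABS n m ` K"
    by (intro Max_in) auto
  then obtain k' where k': "k' \<in> K" and eq: "Max (multipartite_ABS n m ` K) = multipartite_ABS n m k'"
    by auto
  have max: "multipartite_ABS n m k \<le> multipartite_ABS n m k'" if "k \<in> K" for k
    unfolding eq[symmetric] using that \<open>finite K\<close> by (intro Max_ge) auto
  have max': "multipartite_ABS n m k \<le> multipartite_ABS n m k'" if "(\<Sum>i<m. k i) = n" for k
    using max[OF in_K[OF that]] by (simp add: restrict)
  have sum': "(\<Sum>i<m. k' i) = n" using k' by (simp add: K_def)
  have "k' i \<le> k' j + 1" if "i < m" "j < m" for i j
  proof (rule ccontr)
    assume "\<not> k' i \<le> k' j + 1"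
    then have "k' j + 2 \<le> k' i" by simp
    from multipartite_ABS_transfer[OF \<open>3 \<le> n\<close> sum' that this]
    show False using max' leD by blast
  qed
  then have "multipartite_ABS n m k' = turan_ABS n m"
    using sum' \<open>0 < m\<close> by (intro multipartite_ABS_balanced_eq_turan) auto
  with max'[OF sum] show ?thesis by simp
qed

text \<open>From an unbalanced vector attaining the maximum, a transfer would exceed the bound just
  proved.\<close>

lemma multipartite_ABS_eq_turan_iff:
  assumes "3 \<le> n" "0 < m" and sum: "(\<Sum>i<m. k i) = n"
  shows "multipartite_ABS n m k = turan_ABS n m \<longleftrightarrow> (\<forall>i<m. \<forall>j<m. k i \<le> k j + 1)"
proof
  assume eq: "multipartite_ABS n m k = turan_ABS n m"
  show "\<forall>i<m. \<forall>j<m. k i \<le> k j + 1"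
  proof (intro allI impI, rule ccontr)
    fix i j assume "i < m" "j < m" "\<not> k i \<le> k j + 1"
    then have "k j + 2 \<le> k i" by simp
    note t = multipartite_ABS_transfer[OF \<open>3 \<le> n\<close> sum \<open>i < m\<close> \<open>j < m\<close> this]
    show False
      using t(2) multipartite_ABS_le_turan[OF assms(1,2) t(1)] eq by linarith
  qed
qed (use assms in \<open>auto intro!: multipartite_ABS_balanced_eq_turan\<close>)


section \<open>Comparing a coloured graph with the complete multipartite graph on its
  classes\<close>

lemma degree_eq_card: "degree G v = card (parcs G `` {v})"
proof -
  have "out_arcs (with_proj G) v = Pair v ` (parcs G `` {v})"
    by (auto simp: out_arcs_def)
  then show ?thesis
    by (simp add: degree_def out_degree_def card_image inj_on_def)
qed

text \<open>Each edge comes from exactly two opposite arcs, distinct because there are no loops.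
  Ordered pairs match the double sum in \<open>multipartite_ABS\<close>.\<close>

lemma ABS_eq_arc_sum:
  assumes "pair_graph G"
  shows "2 * ABS G = (\<Sum>(u, v)\<in>parcs G. edge_weight (real (degree G u) + real (degree G v)))"
proof -
  interpret pair_graph G by fact
  define h where "h = (\<lambda>(u, v). edge_weight (real (degree G u) + real (degree G v)))"
  define g :: "'a \<times> 'a \<Rightarrow> 'a set" where "g = (\<lambda>(u, v). {u, v})"
  have "sum h (parcs G) = (\<Sum>e\<in>g ` parcs G. sum h {a \<in> parcs G. g a = e})"
    by (rule sum.image_gen) (rule pair_finite_arcs)
  also have "\<dots> = (\<Sum>e\<in>g ` parcs G. 2 * edge_weight (real (\<Sum>w\<in>e. degree G w)))"
  proof (rule sum.cong, rule refl)
    fix e assume "e \<in> g ` parcs G"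
    then obtain u v where uv: "(u, v) \<in> parcs G" "e = {u, v}"
      by (auto simp: g_def)
    then have "u \<noteq> v" using no_loops' by auto
    have "{a \<in> parcs G. g a = e} = {(u, v), (v, u)}"
      using uv arcs_symmetric by (auto simp: g_def doubleton_eq_iff)
    then show "sum h {a \<in> parcs G. g a = e} = 2 * edge_weight (real (\<Sum>w\<in>e. degree G w))"
      using uv \<open>u \<noteq> v\<close> by (simp add: h_def add.commute)
  qed
  also have "\<dots> = 2 * ABS G"
    by (simp add: ABS_def edges_def g_def edge_weight_def sum_distrib_left)
  finally show ?thesis by (simp add: h_def)
qed

definition color_class_size :: "'a pair_pre_digraph \<Rightarrow> ('a \<Rightarrow> nat) \<Rightarrow> nat \<Rightarrow> nat" where
  "color_class_size G c i = card {v \<in> pverts G. c v = i}"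

text \<open>The arc set of the complete multipartite graph on the colour classes, kept on the
  vertices of \<open>G\<close> so that the embedding of \<open>G\<close> is an inclusion.\<close>

definition bichromatic_pairs :: "'a pair_pre_digraph \<Rightarrow> ('a \<Rightarrow> nat) \<Rightarrow> ('a \<times> 'a) set" where
  "bichromatic_pairs G c = {(u, v). u \<in> pverts G \<and> v \<in> pverts G \<and> c u \<noteq> c v}"

lemma sum_by_color:
  fixes h :: "nat \<Rightarrow> real"
  assumes "finite (pverts G)" "\<forall>v\<in>pverts G. c v < m"
  shows "(\<Sum>v\<in>pverts G. h (c v)) = (\<Sum>i<m. real (color_class_size G c i) * h i)"
proof -
  have "(\<Sum>v\<in>pverts G. h (c v)) = (\<Sum>i<m. \<Sum>v\<in>{v \<in> pverts G. c v = i}. h (c v))"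
    using assms by (intro sum.group[symmetric]) auto
  then show ?thesis by (simp add: color_class_size_def)
qed

lemma sum_color_class_size:
  assumes "finite (pverts G)" "\<forall>v\<in>pverts G. c v < m"
  shows "(\<Sum>i<m. color_class_size G c i) = card (pverts G)"
proof -
  have "real (\<Sum>i<m. color_class_size G c i) = real (card (pverts G))"
    using sum_by_color[OF assms, of "\<lambda>_. 1"] by simp
  then show ?thesis by (simp only: of_nat_eq_iff)
qed

text \<open>The summand depends only on the two colours, so grouping both vertices by colour
  produces the products of class sizes.\<close>

lemma bichromatic_pairs_sum:
  assumes "finite (pverts G)" "\<forall>v\<in>pverts G. c v < m"
  shows "(\<Sum>(u, v)\<in>bichromatic_pairs G c.
      edge_weight (2 * real n - real (color_class_size G c (c u)) - real (color_class_size G c (c v))))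
    = 2 * multipartite_ABS n m (color_class_size G c)"
proof -
  let ?V = "pverts G" and ?k = "color_class_size G c"
  \<comment> \<open>The value 0 on equal colours extends the sum to all pairs of vertices, where it
    factors by colour.\<close>
  define h where "h i j = (if i = j then 0 else
    edge_weight (2 * real n - real (?k i) - real (?k j)))" for i j
  have "(\<Sum>(u, v)\<in>bichromatic_pairs G c.
      edge_weight (2 * real n - real (?k (c u)) - real (?k (c v))))
    = (\<Sum>(u, v)\<in>?V \<times> ?V. h (c u) (c v))"
    using assms by (intro sum.mono_neutral_cong_left) (auto simp: bichromatic_pairs_def h_def)
  also have "\<dots> = (\<Sum>u\<in>?V. \<Sum>v\<in>?V. h (c u) (c v))"
    by (simp add: sum.cartesian_product)
  also have "\<dots> = (\<Sum>i<m. real (?k i) * (\<Sum>j<m. real (?k j) * h i j))"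
    by (simp add: sum_by_color[OF assms])
      (simp add: sum_by_color[OF assms, of "\<lambda>i. \<Sum>j<m. real (?k j) * h i j"])
  also have "\<dots> = (\<Sum>i<m. \<Sum>j<m. if i = j then 0 else
      real (?k i) * real (?k j) * edge_weight (2 * real n - real (?k i) - real (?k j)))"
    unfolding sum_distrib_left by (intro sum.cong refl) (simp add: h_def)
  also have "\<dots> = 2 * multipartite_ABS n m ?k"
    by (simp add: multipartite_ABS_def)
  finally show ?thesis .
qed

text \<open>Two steps: on arcs of \<open>G\<close> the weight grows because
  \<open>degree G u\<close> is at most \<open>n\<close> minus the class size of \<open>u\<close>;
  then the missing bichromatic pairs are added, each with positive weight. If none is missing, every
  degree bound is attained.\<close>

lemma ABS_le_multipartite_ABS:
  assumes "pair_graph G" and col: "proper_coloring G m c"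
    and n: "card (pverts G) = n" "3 \<le> n"
  shows "ABS G \<le> multipartite_ABS n m (color_class_size G c)"
    and "ABS G = multipartite_ABS n m (color_class_size G c) \<longleftrightarrow> parcs G = bichromatic_pairs G c"
proof -
  interpret pair_graph G by fact
  let ?V = "pverts G" and ?A = "parcs G" and ?K = "bichromatic_pairs G c"
  let ?k = "color_class_size G c"
  define h where "h = (\<lambda>(u, v). edge_weight (real (degree G u) + real (degree G v)))"
  define h' where "h' = (\<lambda>(u, v). edge_weight (2 * real n - real (?k (c u)) - real (?k (c v))))"
  have fin: "finite ?V" "\<forall>v\<in>?V. c v < m"
    using pair_finite_verts col by (auto simp: proper_coloring_def)
  have sub: "?A \<subseteq> ?K"
    using col in_arcsD1 in_arcsD2 by (auto simp: proper_coloring_def bichromatic_pairs_def)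
  have "finite ?K"
    by (rule finite_subset[of _ "?V \<times> ?V"]) (use fin in \<open>auto simp: bichromatic_pairs_def\<close>)
  have codegree: "card {v \<in> ?V. c v \<noteq> c u} = n - ?k (c u)" "?k (c u) \<le> n" for u
  proof -
    show "?k (c u) \<le> n"
      unfolding color_class_size_def n(1)[symmetric] using fin(1) by (intro card_mono) auto
    have "{v \<in> ?V. c v \<noteq> c u} = ?V - {v \<in> ?V. c v = c u}" by auto
    also have "card \<dots> = n - ?k (c u)"
      unfolding color_class_size_def n(1)[symmetric] using fin(1) by (intro card_Diff_subset) auto
    finally show "card {v \<in> ?V. c v \<noteq> c u} = n - ?k (c u)" .
  qed
  have degree_le: "degree G u + ?k (c u) \<le> n" for u
  proof -
    have "degree G u \<le> card {v \<in> ?V. c v \<noteq> c u}"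
      unfolding degree_eq_card
      using sub fin by (intro card_mono) (auto simp: bichromatic_pairs_def)
    then show ?thesis using codegree[of u] by simp
  qed
  \<comment> \<open>Both ends of an arc have degree at least 1, so its degree sum is at least 2,
    where \<open>edge_weight\<close> becomes monotone.\<close>
  have degree_pos: "1 \<le> degree G u" if "(u, v) \<in> ?A" for u v
  proof -
    have "?A `` {u} \<subseteq> ?V" using in_arcsD2 by auto
    then have "finite (?A `` {u})" using fin finite_subset by auto
    then have "0 < card (?A `` {u})" using that by (auto simp: card_gt_0_iff)
    then show ?thesis by (simp add: degree_eq_card)
  qed
  \<comment> \<open>Two different classes have at most \<open>n\<close> vertices together, so the
    argument of the weight is at least \<open>n > 2\<close>.\<close>
  have pos: "0 < h' a" if "a \<in> ?K" for a
  proof -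
    obtain u v where a: "a = (u, v)" "c u \<noteq> c v" "u \<in> ?V" "v \<in> ?V"
      using \<open>a \<in> ?K\<close> by (auto simp: bichromatic_pairs_def)
    have "?k (c u) + ?k (c v) = sum ?k {c u, c v}"
      using a by simp
    also have "\<dots> \<le> sum ?k {..<m}"
      using a fin by (intro sum_mono2) auto
    also have "\<dots> = n"
      using sum_color_class_size[OF fin] n by simp
    finally show ?thesis
      using n(2) a(1) by (auto simp: h'_def intro!: edge_weight_pos)
  qed
  have le: "h a \<le> h' a" if "a \<in> ?A" for a
  proof -
    obtain u v where a: "a = (u, v)" by fastforce
    then have "1 \<le> degree G u" "1 \<le> degree G v"
      using that degree_pos arcs_symmetric by blast+
    then show ?thesis
      using degree_le[of u] degree_le[of v] by (auto simp: a h_def h'_def intro!: edge_weight_mono)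
  qed
  have A: "2 * ABS G = sum h ?A"
    unfolding h_def by (rule ABS_eq_arc_sum) fact
  have K: "2 * multipartite_ABS n m ?k = sum h' ?K"
    unfolding h'_def by (rule bichromatic_pairs_sum[OF fin, symmetric])
  have "sum h ?A \<le> sum h' ?A" by (intro sum_mono le)
  moreover have "sum h' ?A \<le> sum h' ?K"
    using sub \<open>finite ?K\<close> pos by (intro sum_mono2) (auto intro: less_imp_le)
  ultimately show "ABS G \<le> multipartite_ABS n m ?k"
    using A K by simp
  show "ABS G = multipartite_ABS n m ?k \<longleftrightarrow> ?A = ?K"
  proof
    assume eq: "ABS G = multipartite_ABS n m ?k"
    show "?A = ?K"
    proof (rule ccontr)
      assume "?A \<noteq> ?K"
      \<comment> \<open>A missing pair has positive weight and makes the second step strict.\<close>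
      then obtain b where "b \<in> ?K - ?A" using sub by auto
      then have "sum h' ?A < sum h' ?K"
        using sub \<open>finite ?K\<close> pos by (intro sum_strict_mono2[of _ _ b]) (auto intro: less_imp_le)
      with \<open>sum h ?A \<le> sum h' ?A\<close> show False using A K eq by simp
    qed
  next
    assume eq: "?A = ?K"
    have "real (degree G u) = real n - real (?k (c u))" if "u \<in> ?V" for u
    proof -
      have "?A `` {u} = {v \<in> ?V. c v \<noteq> c u}"
        using that unfolding eq by (auto simp: bichromatic_pairs_def)
      then show ?thesis
        using codegree[of u] by (simp add: degree_eq_card of_nat_diff)
    qed
    then have "sum h ?A = sum h' ?K"
      unfolding eq by (intro sum.cong) (auto simp: h_def h'_def bichromatic_pairs_def intro!: arg_cong[where f = edge_weight])
    then show "ABS G = multipartite_ABS n m ?k"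
      using A K by simp
  qed
qed

text \<open>An injective numbering of the vertices is proper, as there are no loops, so the least
  number of colours is attained.\<close>

lemma ex_proper_coloring_chromatic_number:
  assumes "pair_graph G"
  shows "\<exists>c. proper_coloring G (chromatic_number G) c"
proof -
  interpret pair_graph G by fact
  obtain f :: "'a \<Rightarrow> nat" and N where f: "f ` pverts G = {i. i < N}" "inj_on f (pverts G)"
    using finite_imp_inj_to_nat_seg[OF pair_finite_verts] by metis
  have "proper_coloring G N f"
    unfolding proper_coloring_def
  proof safe
    show "f v < N" if "v \<in> pverts G" for v using that f by auto
    show False if "(u, v) \<in> parcs G" "f u = f v" for u v
      using that f(2) no_loops' in_arcsD1 in_arcsD2 by (metis inj_onD)
  qed
  then have "\<exists>k c. proper_coloring G k c" by blast
  then show ?thesis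
    unfolding chromatic_number_def by (rule LeastI_ex)
qed

section \<open>Isomorphism with the Turan graph\<close>

lemma digraph_iso_with_projI:
  assumes "pair_wf_digraph G" and inj: "inj_on f (pverts G)"
    and verts: "pverts H = f ` pverts G" and arcs: "parcs H = map_prod f f ` parcs G"
  shows "digraph_iso (with_proj G) (with_proj H)"
proof -
  interpret pair_wf_digraph G by fact
  define hom where "hom = \<lparr>iso_verts = f, iso_arcs = map_prod f f, iso_head = snd, iso_tail = fst\<rparr>"
  have "inj_on (map_prod f f) (parcs G)"
    by (rule inj_on_subset[OF map_prod_inj_on[OF inj inj]]) (auto dest: in_arcsD1 in_arcsD2)
  then have "pre_digraph.digraph_isomorphism (with_proj G) hom"
    unfolding pre_digraph.digraph_isomorphism_def
    using inj wf_digraph_axioms by (auto simp: hom_def)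
  moreover have "with_proj H = app_iso hom (with_proj G)"
    by (simp add: app_iso_def hom_def with_proj_def verts arcs)
  ultimately show ?thesis
    unfolding digraph_iso_def by blast
qed

text \<open>An isomorphism carries separate maps for vertices and arcs; compatibility with tails and
  heads, which are the projections here, forces the arc map to be induced by the vertex map.\<close>

lemma digraph_iso_with_projE:
  assumes "digraph_iso (with_proj G) (with_proj H)"
  obtains f where "inj_on f (pverts G)" "pverts H = f ` pverts G" "parcs H = map_prod f f ` parcs G"
proof -
  obtain hom where hom: "pre_digraph.digraph_isomorphism (with_proj G) hom"
    "with_proj H = app_iso hom (with_proj G)"
    using assms by (auto simp: digraph_iso_def)
  then have eqs: "pverts H = iso_verts hom ` pverts G" "parcs H = iso_arcs hom ` parcs G"
    "iso_tail hom = fst" "iso_head hom = snd"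
    by (simp_all add: app_iso_def with_proj_def)
  have "iso_arcs hom a = map_prod (iso_verts hom) (iso_verts hom) a" if "a \<in> parcs G" for a
    using hom(1) that unfolding pre_digraph.digraph_isomorphism_def
    by (cases a) (auto simp: eqs prod_eq_iff)
  then have "parcs H = map_prod (iso_verts hom) (iso_verts hom) ` parcs G"
    unfolding eqs by (rule image_cong[OF refl])
  then show thesis
    using that[of "iso_verts hom"] hom(1) eqs
    by (auto simp: pre_digraph.digraph_isomorphism_def)
qed

lemma pverts_turan_graph: "pverts (turan_graph n m) = (SIGMA i:{..<m}. {..<turan_part_size n m i})"
  and parcs_turan_graph: "parcs (turan_graph n m) =
    {(u, v). u \<in> pverts (turan_graph n m) \<and> v \<in> pverts (turan_graph n m) \<and> fst u \<noteq> fst v}"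
  by (simp_all add: turan_graph_def complete_multipartite_def Let_def)

text \<open>Both vectors have exactly \<open>n mod m\<close> larger parts; a bijection between these
  is glued to one between the smaller parts.\<close>

lemma ex_permutation_turan_part_size:
  assumes "0 < m" "(\<Sum>i<m. k i) = n" "\<And>i j. i < m \<Longrightarrow> j < m \<Longrightarrow> k i \<le> k j + 1"
  obtains \<pi> where "bij_betw \<pi> {..<m} {..<m}" "\<And>i. i < m \<Longrightarrow> turan_part_size n m (\<pi> i) = k i"
proof -
  obtain S where S: "S \<subseteq> {..<m}" "card S = n mod m"
    and k: "\<And>i. i < m \<Longrightarrow> k i = n div m + (if i \<in> S then 1 else 0)"
    using balanced_sizes[OF assms] by blast
  have "n mod m < m" using \<open>0 < m\<close> by simp
  have fin: "finite S" using S finite_subset by auto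
  obtain f where f: "bij_betw f S {..<n mod m}"
    using finite_same_card_bij[of S "{..<n mod m}"] S fin by auto
  have "card ({..<m} - S) = card {n mod m..<m}"
    using S fin by (simp add: card_Diff_subset)
  then obtain g where g: "bij_betw g ({..<m} - S) {n mod m..<m}"
    using finite_same_card_bij[of "{..<m} - S" "{n mod m..<m}"] by auto
  define \<pi> where "\<pi> i = (if i \<in> S then f i else g i)" for i
  have "bij_betw \<pi> S {..<n mod m}"
    using f by (rule bij_betw_cong[THEN iffD1, rotated]) (simp add: \<pi>_def)
  moreover have "bij_betw \<pi> ({..<m} - S) {n mod m..<m}"
    using g by (rule bij_betw_cong[THEN iffD1, rotated]) (simp add: \<pi>_def)
  ultimately have "bij_betw \<pi> (S \<union> ({..<m} - S)) ({..<n mod m} \<union> {n mod m..<m})"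
    by (rule bij_betw_combine) auto
  moreover have "S \<union> ({..<m} - S) = {..<m}" "{..<n mod m} \<union> {n mod m..<m} = {..<m}"
    using S \<open>n mod m < m\<close> by auto
  ultimately have "bij_betw \<pi> {..<m} {..<m}" by simp
  moreover have "turan_part_size n m (\<pi> i) = k i" if "i < m" for i
  proof (cases "i \<in> S")
    case True
    then have "f i < n mod m" using f by (auto simp: bij_betw_def)
    with True that show ?thesis by (simp add: k \<pi>_def turan_part_size_def)
  next
    case False
    then have "n mod m \<le> g i" using g that by (auto simp: bij_betw_def)
    with False that show ?thesis by (simp add: k \<pi>_def turan_part_size_def)
  qed
  ultimately show thesis by (rule that)
qed

text \<open>Permuting the colours by \<open>\<pi>\<close> makes the class sizes agree with the
  parts, and \<open>g i\<close> numbers the vertices of colour \<open>i\<close>; together they give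
  the coordinates of the image vertex.\<close>

lemma digraph_iso_turan_graphI:
  assumes "pair_graph G" and col: "\<forall>v\<in>pverts G. c v < m"
    and n: "card (pverts G) = n" "0 < n"
    and arcs: "parcs G = bichromatic_pairs G c"
    and bal: "\<And>i j. i < m \<Longrightarrow> j < m \<Longrightarrow> color_class_size G c i \<le> color_class_size G c j + 1"
  shows "digraph_iso (with_proj G) (with_proj (turan_graph n m))"
proof -
  interpret pair_graph G by fact
  let ?V = "pverts G" and ?k = "color_class_size G c"
  have "0 < m" using n col by (metis card_gt_0_iff ex_in_conv gr_implies_not0 neq0_conv)
  have "(\<Sum>i<m. ?k i) = n"
    using sum_color_class_size[OF pair_finite_verts col] n by simp
  then obtain \<pi> where \<pi>: "bij_betw \<pi> {..<m} {..<m}"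
    and size: "\<And>i. i < m \<Longrightarrow> turan_part_size n m (\<pi> i) = ?k i"
    using ex_permutation_turan_part_size[of m ?k n] bal \<open>0 < m\<close> by blast
  have "\<forall>i. \<exists>g. bij_betw g {v \<in> ?V. c v = i} {..<?k i}"
    using pair_finite_verts by (intro allI finite_same_card_bij) (auto simp: color_class_size_def)
  then obtain g where g: "\<And>i. bij_betw (g i) {v \<in> ?V. c v = i} {..<?k i}"
    using choice[of "\<lambda>i g. bij_betw g {v \<in> ?V. c v = i} {..<?k i}"] by auto
  define f where "f v = (\<pi> (c v), g (c v) v)" for v
  have \<pi>_eq: "\<pi> i = \<pi> j \<longleftrightarrow> i = j" if "i < m" "j < m" for i j
    using \<pi> that by (auto simp: bij_betw_def inj_on_def)
  have inj: "inj_on f ?V"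
  proof (rule inj_onI)
    fix u v assume uv: "u \<in> ?V" "v \<in> ?V" "f u = f v"
    then have "c u = c v" using \<pi>_eq col by (auto simp: f_def)
    then show "u = v"
      using uv g[of "c v"] by (auto simp: f_def bij_betw_def dest: inj_onD)
  qed
  have verts: "pverts (turan_graph n m) = f ` ?V"
  proof (intro equalityI subsetI)
    fix x assume "x \<in> pverts (turan_graph n m)"
    then obtain i y where x: "x = (i, y)" "i < m" "y < turan_part_size n m i"
      by (auto simp: pverts_turan_graph)
    obtain j where j: "j < m" "i = \<pi> j"
      using \<pi> x by (auto simp: bij_betw_def)
    then have "y \<in> {..<?k j}" using x size by simp
    then obtain v where "v \<in> ?V" "c v = j" "y = g j v"
      using g[of j] by (auto simp: bij_betw_def)
    then show "x \<in> f ` ?V"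
      using x j by (auto simp: f_def)
  next
    fix x assume "x \<in> f ` ?V"
    then obtain v where v: "v \<in> ?V" "x = f v" by auto
    have "g (c v) v < ?k (c v)" using v g[of "c v"] by (auto simp: bij_betw_def)
    moreover have "\<pi> (c v) < m" using \<pi> v col by (auto simp: bij_betw_def)
    ultimately show "x \<in> pverts (turan_graph n m)"
      using v col size by (auto simp: pverts_turan_graph f_def)
  qed
  have "parcs (turan_graph n m) = map_prod f f ` parcs G"
    unfolding parcs_turan_graph verts arcs bichromatic_pairs_def
  proof (intro equalityI subsetI)
    fix a assume "a \<in> {(x, y). x \<in> f ` ?V \<and> y \<in> f ` ?V \<and> fst x \<noteq> fst y}"
    then obtain u v where "a = (f u, f v)" "u \<in> ?V" "v \<in> ?V" "\<pi> (c u) \<noteq> \<pi> (c v)"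
      by (auto simp: f_def)
    then show "a \<in> map_prod f f ` {(u, v). u \<in> ?V \<and> v \<in> ?V \<and> c u \<noteq> c v}"
      by (intro image_eqI[of _ _ "(u, v)"]) auto
  next
    fix a assume "a \<in> map_prod f f ` {(u, v). u \<in> ?V \<and> v \<in> ?V \<and> c u \<noteq> c v}"
    then obtain u v where "a = (f u, f v)" "u \<in> ?V" "v \<in> ?V" "c u \<noteq> c v"
      by auto
    then show "a \<in> {(x, y). x \<in> f ` ?V \<and> y \<in> f ` ?V \<and> fst x \<noteq> fst y}"
      using col \<pi>_eq by (simp add: f_def)
  qed
  with inj verts show ?thesis
    by (intro digraph_iso_with_projI pair_wf_digraph)
qed

text \<open>The part index in the Turan graph, pulled back along the isomorphism, is the
  colouring.\<close>

lemma digraph_iso_turan_graphD: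
  assumes "pair_wf_digraph G" and iso: "digraph_iso (with_proj G) (with_proj (turan_graph n m))"
  obtains c where "proper_coloring G m c" "parcs G = bichromatic_pairs G c"
    "\<And>i. i < m \<Longrightarrow> color_class_size G c i = turan_part_size n m i"
proof -
  interpret pair_wf_digraph G by fact
  let ?H = "turan_graph n m"
  obtain f where inj: "inj_on f (pverts G)" and verts: "pverts ?H = f ` pverts G"
    and arcs: "parcs ?H = map_prod f f ` parcs G"
    using digraph_iso_with_projE[OF iso] .
  define c where "c = fst \<circ> f"
  have arc_iff: "(u, v) \<in> parcs G \<longleftrightarrow> (f u, f v) \<in> parcs ?H" if "u \<in> pverts G" "v \<in> pverts G" for u v
  proof
    assume "(f u, f v) \<in> parcs ?H"
    then obtain u' v' where "(u', v') \<in> parcs G" "f u = f u'" "f v = f v'"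
      by (auto simp: arcs)
    with that inj show "(u, v) \<in> parcs G"
      by (metis in_arcsD1 in_arcsD2 inj_onD)
  qed (auto simp: arcs)
  have arc_H_iff: "(f u, f v) \<in> parcs ?H \<longleftrightarrow> c u \<noteq> c v" if "u \<in> pverts G" "v \<in> pverts G" for u v
    using that by (simp add: parcs_turan_graph verts c_def)
  have parcs: "parcs G = bichromatic_pairs G c"
    unfolding bichromatic_pairs_def
  proof (intro equalityI subrelI)
    fix u v assume "(u, v) \<in> parcs G"
    moreover from this have "u \<in> pverts G" "v \<in> pverts G"
      by (rule in_arcsD1, rule in_arcsD2)
    ultimately show "(u, v) \<in> {(u, v). u \<in> pverts G \<and> v \<in> pverts G \<and> c u \<noteq> c v}"
      using arc_iff arc_H_iff by simp
  next
    fix u v assume "(u, v) \<in> {(u, v). u \<in> pverts G \<and> v \<in> pverts G \<and> c u \<noteq> c v}"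
    then show "(u, v) \<in> parcs G"
      using arc_iff arc_H_iff by simp
  qed
  have "c v < m" if "v \<in> pverts G" for v
  proof -
    have "f v \<in> pverts ?H" using that verts by simp
    then show ?thesis by (auto simp: pverts_turan_graph c_def)
  qed
  then have "proper_coloring G m c"
    by (auto simp: proper_coloring_def parcs bichromatic_pairs_def)
  moreover have "color_class_size G c i = turan_part_size n m i" if "i < m" for i
  proof -
    have "f ` {v \<in> pverts G. c v = i} = {x \<in> pverts ?H. fst x = i}"
      unfolding verts c_def by auto
    also have "\<dots> = Pair i ` {..<turan_part_size n m i}"
      using that by (auto simp: pverts_turan_graph)
    finally have "card (f ` {v \<in> pverts G. c v = i}) = turan_part_size n m i"
      by (simp add: card_image inj_on_def)
    moreover have "inj_on f {v \<in> pverts G. c v = i}"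
      using inj by (rule inj_on_subset) auto
    ultimately show ?thesis
      by (simp add: color_class_size_def card_image)
  qed
  ultimately show thesis using parcs that by blast
qed

section \<open>The bound, its equality case and the closed form\<close>

text \<open>The value for the class sizes of \<open>c\<close> lies between \<open>ABS G\<close> and
  \<open>turan_ABS n m\<close>, so equality of the ends forces both intermediate equalities: all
  bichromatic pairs are arcs, and the sizes are balanced.\<close>

lemma ABS_le_turan_ABS:
  assumes "pair_graph G" and col: "proper_coloring G m c"
    and n: "card (pverts G) = n" "3 \<le> n"
  shows "ABS G \<le> turan_ABS n m"
    and "ABS G = turan_ABS n m \<longleftrightarrow> digraph_iso (with_proj G) (with_proj (turan_graph n m))"
proof -
  interpret pair_graph G by fact
  have lt: "\<forall>v\<in>pverts G. c v < m"
    using col by (simp add: proper_coloring_def)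
  have "pverts G \<noteq> {}" using n by auto
  with lt have "0 < m" by fastforce
  note sum = sum_color_class_size[OF pair_finite_verts lt, unfolded n(1)]
  note G = ABS_le_multipartite_ABS[OF assms]
  note k = multipartite_ABS_le_turan[OF n(2) \<open>0 < m\<close> sum]
  from G(1) k show "ABS G \<le> turan_ABS n m" by simp
  show "ABS G = turan_ABS n m \<longleftrightarrow> digraph_iso (with_proj G) (with_proj (turan_graph n m))"
  proof
    assume "ABS G = turan_ABS n m"
    then have eqs: "ABS G = multipartite_ABS n m (color_class_size G c)"
      "multipartite_ABS n m (color_class_size G c) = turan_ABS n m"
      using G(1) k by simp_all
    show "digraph_iso (with_proj G) (with_proj (turan_graph n m))"
    proof (rule digraph_iso_turan_graphI[OF \<open>pair_graph G\<close> lt n(1)])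
      show "parcs G = bichromatic_pairs G c" using eqs(1) G(2) by simp
      show "color_class_size G c i \<le> color_class_size G c j + 1" if "i < m" "j < m" for i j
        using eqs(2) that multipartite_ABS_eq_turan_iff[OF n(2) \<open>0 < m\<close> sum] by blast
    qed (use n in simp)
  next
    assume "digraph_iso (with_proj G) (with_proj (turan_graph n m))"
    \<comment> \<open>The given \<open>c\<close> has no stated relation to the isomorphism; the
      colouring induced by the latter has the required class sizes.\<close>
    then obtain c' where c': "proper_coloring G m c'" "parcs G = bichromatic_pairs G c'"
      "\<And>i. i < m \<Longrightarrow> color_class_size G c' i = turan_part_size n m i"
      using digraph_iso_turan_graphD[OF pair_wf_digraph] by metis
    have "ABS G = multipartite_ABS n m (color_class_size G c')"
      using ABS_le_multipartite_ABS(2)[OF \<open>pair_graph G\<close> c'(1) n] c'(2) by simp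
    also have "\<dots> = turan_ABS n m"
      unfolding turan_ABS_def by (rule multipartite_ABS_cong) (rule c'(3))
    finally show "ABS G = turan_ABS n m" .
  qed
qed

lemma turan_ABS_eq:
  fixes n m :: nat
  assumes "0 < m"
  defines "q \<equiv> n div m" and "r \<equiv> n - n div m * m"
  shows "turan_ABS n m =
      (real m - real r) * (real m - real r - 1) * (real q)\<^sup>2 / 2
            * sqrt ((real n - real q - 1) / (real n - real q))
        + real r * (real m - real r) * real q * (real q + 1)
            * sqrt ((2 * real n - 2 * real q - 3) / (2 * real n - 2 * real q - 1))
        + real r * (real r - 1) * (real q + 1)\<^sup>2 / 2
            * sqrt ((real n - real q - 2) / (real n - real q - 1))"
proof -
  have r: "r = n mod m"
    by (simp add: r_def minus_div_mult_eq_mod)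
  have "n mod m < m" using assms by simp
  \<comment> \<open>The degree sums \<open>2n - 2q\<close> and \<open>2n - 2q - 2\<close> of
    equal-sized parts allow a factor 2 to be cancelled; the mixed sum \<open>2n - 2q - 1\<close> is
    odd and keeps its form.\<close>
  have half: "edge_weight (2 * t) = sqrt ((t - 1) / t)" for t
  proof -
    have "(2 * t - 2) / (2 * t) = (2 * (t - 1)) / (2 * t)" by (simp add: algebra_simps)
    then show ?thesis unfolding edge_weight_def by (simp only: mult_divide_mult_cancel_left_if) simp
  qed
  have weights: "edge_weight (2 * real n - 2 * real q) = sqrt ((real n - real q - 1) / (real n - real q))"
    "edge_weight (2 * real n - 2 * real q - 1) =
      sqrt ((2 * real n - 2 * real q - 3) / (2 * real n - 2 * real q - 1))"
    "edge_weight (2 * real n - 2 * real q - 2) = sqrt ((real n - real q - 2) / (real n - real q - 1))"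
    using half[of "real n - real q"] half[of "real n - real q - 1"]
    by (simp_all add: edge_weight_def algebra_simps)
  have "turan_ABS n m =
      (real m - real r) * (real m - real r - 1) * (real q)\<^sup>2 / 2 * edge_weight (2 * real n - 2 * real q)
    + real r * (real m - real r) * real q * (real q + 1) * edge_weight (2 * real n - 2 * real q - 1)
    + real r * (real r - 1) * (real q + 1)\<^sup>2 / 2 * edge_weight (2 * real n - 2 * real q - 2)"
    unfolding turan_ABS_def
    by (rule multipartite_ABS_balanced[of "{..<n mod m}"])
      (use \<open>n mod m < m\<close> in \<open>auto simp: turan_part_size_def q_def r\<close>)
  then show ?thesis unfolding weights .
qed

theorem theorem3:
  fixes G :: "'a pair_pre_digraph" and n \<chi> :: nat
  assumes "n \<ge> 5" and "\<chi> \<ge> 3"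
    and "pair_graph G"
    and "Digraph_Component.connected (with_proj G)"
    and "card (pverts G) = n"
    and "chromatic_number G = \<chi>"
  shows "let q = n div \<chi>; r = n - q * \<chi>;
      B = (real \<chi> - real r) * (real \<chi> - real r - 1) * (real q)\<^sup>2 / 2
            * sqrt ((real n - real q - 1) / (real n - real q))
        + real r * (real \<chi> - real r) * real q * (real q + 1)
            * sqrt ((2 * real n - 2 * real q - 3) / (2 * real n - 2 * real q - 1))
        + real r * (real r - 1) * (real q + 1)\<^sup>2 / 2
            * sqrt ((real n - real q - 2) / (real n - real q - 1))
    in ABS G \<le> B \<and>
       (ABS G = B \<longleftrightarrow> digraph_iso (with_proj G) (with_proj (turan_graph n \<chi>)))"
proof -
  obtain c where "proper_coloring G \<chi> c"
    using ex_proper_coloring_chromatic_number[OF \<open>pair_graph G\<close>] assms by auto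
  from ABS_le_turan_ABS[OF \<open>pair_graph G\<close> this \<open>card (pverts G) = n\<close>] \<open>n \<ge> 5\<close> \<open>\<chi> \<ge> 3\<close>
  show ?thesis
    unfolding Let_def by (simp only: turan_ABS_eq[symmetric])
qed

end
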